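(* Let $a,b,n,m,\ell\ge0$ be integers with $a+m=b+n=\ell$. Then, for $\sigma\in\mathfrak{S}_a$ and $\tau\in\mathfrak{S}_b$, $$\sum_{\pi\in \mathfrak{S}_\ell(\sigma,\tau)} p^{\operatorname{imaj}(\pi_{> a})}q^{\operatorname{maj}(\pi^{> b})} = \sum_{\substack{j\in J(\sigma,\tau)\\ k=n-a+j}} p^{\operatorname{imaj}(\tau_{>j})}q^{\operatorname{maj}(\sigma^{>j})} \genfrac{[}{]}{0pt}{}{m}{k}_p \genfrac{[}{]}{0pt}{}{n}{k}_q A_k(p,q).$$ In particular, when $p=q=1$, $$|\mathfrak{S}_\ell(\sigma,\tau)|=\sum_{\substack{j\in J(\sigma,\tau)\\ k=n-a+j}} \binom{m}{k} \binom{n}{k} k!.$$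
   Context: $\mathfrak{S}_N$ is the set of permutations $\pi=\pi_1\cdots\pi_N$ of $[N]$ in one-line notation. For $\pi\in\mathfrak{S}_N$ and $0\le k\le N$: $\pi_{\le k}\in\mathfrak{S}_k$ (resp. $\pi_{>k}\in\mathfrak{S}_{N-k}$) is the permutation order-isomorphic to the subword of $\pi$ consisting of the values $i\le k$ (resp. $i>k$); $\pi^{\le k}\in\mathfrak{S}_k$ (resp. $\pi^{>k}\in\mathfrak{S}_{N-k}$) is the one order-isomorphic to $\pi_1\cdots\pi_k$ (resp. $\pi_{k+1}\cdots\pi_N$). For $\sigma\in\mathfrak{S}_a,\tau\in\mathfrak{S}_b$: $\mathfrak{S}_N(\sigma,\tau)=\{\pi\in\mathfrak{S}_N:\pi_{\le a}=\sigma,\ \pi^{\le b}=\tau\}$, and $J(\sigma,\tau)=\{0\le j\le\min(a,b):\sigma^{\le j}=\tau_{\le j}\}$. $\operatorname{maj}(\pi)$ is the sum of all $i\in[N-1]$ with $\pi_i>\pi_{i+1}$; $\operatorname{imaj}(\pi)=\operatorname{maj}(\pi^{-1})$; $A_k(p,q)=\sum_{\pi\in\mathfrak{S}_k}p^{\operatorname{imaj}(\pi)}q^{\operatorname{maj}(\pi)}$. $[n]_q!=\prod_{i=1}^n(1+q+\cdots+q^{i-1})$ and $\genfrac{[}{]}{0pt}{}{n}{k}_q=\frac{[n]_q!}{[k]_q!\,[n-k]_q!}$ for $0\le k\le n$. Terms with $k<0$ are zero. The first identity is between polynomials in $p,q$. *)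

theory Defs
  imports "HOL-Computational_Algebra.Polynomial" "HOL-Combinatorics.Multiset_Permutations"
begin

text \<open>
  A permutation of \<open>{1..N}\<close> is its one-line word, a list in \<^term>\<open>permutations_of_set {1..N}\<close>.
  The letter \<open>\<pi>\<^sub>i\<close> (with \<open>i\<close> counted from 1) is \<^term>\<open>\<pi> ! (i - 1)\<close>.
\<close>

abbreviation Sym :: "nat \<Rightarrow> nat list set" where
  "Sym N \<equiv> permutations_of_set {1..N}"

text \<open>
  The permutation order-isomorphic to a word with distinct letters: each letter is replaced
  by its rank among the letters of the word.
\<close>

definition standardize :: "nat list \<Rightarrow> nat list" where
  "standardize w = map (\<lambda>x. card {y \<in> set w. y \<le> x}) w"

definition values_le :: "nat list \<Rightarrow> nat \<Rightarrow> nat list" where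
  "values_le \<pi> k = standardize (filter (\<lambda>v. v \<le> k) \<pi>)"

definition values_gt :: "nat list \<Rightarrow> nat \<Rightarrow> nat list" where
  "values_gt \<pi> k = standardize (filter (\<lambda>v. v > k) \<pi>)"

definition prefix_le :: "nat list \<Rightarrow> nat \<Rightarrow> nat list" where
  "prefix_le \<pi> k = standardize (take k \<pi>)"

definition suffix_gt :: "nat list \<Rightarrow> nat \<Rightarrow> nat list" where
  "suffix_gt \<pi> k = standardize (drop k \<pi>)"

text \<open>In the next two definitions \<open>a\<close> and \<open>b\<close> are the lengths of \<open>\<sigma>\<close> and \<open>\<tau>\<close>.\<close>

definition Sym_restr :: "nat \<Rightarrow> nat list \<Rightarrow> nat list \<Rightarrow> nat list set" where
  "Sym_restr N \<sigma> \<tau> =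
     {\<pi> \<in> Sym N. values_le \<pi> (length \<sigma>) = \<sigma> \<and> prefix_le \<pi> (length \<tau>) = \<tau>}"

definition J :: "nat list \<Rightarrow> nat list \<Rightarrow> nat set" where
  "J \<sigma> \<tau> = {j. j \<le> min (length \<sigma>) (length \<tau>) \<and> prefix_le \<sigma> j = values_le \<tau> j}"

definition maj :: "nat list \<Rightarrow> nat" where
  "maj \<pi> = \<Sum>{i \<in> {1..<length \<pi>}. \<pi> ! (i - 1) > \<pi> ! i}"

definition perm_inverse :: "nat list \<Rightarrow> nat list" where
  "perm_inverse \<pi> =
     map (inv_into {1..length \<pi>} (\<lambda>i. \<pi> ! (i - 1))) [1..<length \<pi> + 1]"

definition imaj :: "nat list \<Rightarrow> nat" where
  "imaj \<pi> = maj (perm_inverse \<pi>)"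

definition A :: "nat \<Rightarrow> 'a::comm_semiring_1 \<Rightarrow> 'a \<Rightarrow> 'a" where
  "A k p q = (\<Sum>\<pi>\<in>Sym k. p ^ imaj \<pi> * q ^ maj \<pi>)"

definition qfact :: "'a::comm_semiring_1 \<Rightarrow> nat \<Rightarrow> 'a" where
  "qfact q n = (\<Prod>i=1..n. \<Sum>j<i. q ^ j)"

text \<open>Only for \<open>k \<le> n\<close>. The division is exact, see \<open>qbinomial_exact\<close> below.\<close>

definition qbinomial :: "'a::idom_divide \<Rightarrow> nat \<Rightarrow> nat \<Rightarrow> 'a" where
  "qbinomial q n k = qfact q n div (qfact q k * qfact q (n - k))"

lemma qfact_Suc: "qfact q (Suc n) = (\<Sum>j<Suc n. q ^ j) * qfact q n"
  by (simp add: qfact_def mult.commute)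

lemma sum_power_add:
  fixes q :: "'a::comm_semiring_1"
  shows "(\<Sum>j<m + n. q ^ j) = (\<Sum>j<m. q ^ j) + q ^ m * (\<Sum>j<n. q ^ j)"
  by (induction n) (simp_all add: algebra_simps power_add)

lemma qfact_mult_dvd:
  fixes q :: "'a::idom_divide"
  shows "qfact q m * qfact q n dvd qfact q (m + n)"
proof (induction "m + n" arbitrary: m n)
  case 0
  then show ?case by (simp add: qfact_def)
next
  case (Suc s)
  show ?case
  proof (cases "m = 0 \<or> n = 0")
    case True
    then show ?thesis by (auto simp: qfact_def)
  next
    case False
    then obtain m' n' where mn: "m = Suc m'" "n = Suc n'"
      by (metis not0_implies_Suc)
    let ?br = "\<lambda>i. \<Sum>j<i. q ^ j"
    have "qfact q m' * qfact q n dvd qfact q s" "qfact q m * qfact q n' dvd qfact q s"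
      using Suc.hyps(1)[of m' n] Suc.hyps(1)[of m n'] Suc.hyps(2) mn by auto
    then have "?br m * (qfact q m' * qfact q n) dvd ?br m * qfact q s"
      and "?br n * (qfact q m * qfact q n') dvd ?br n * qfact q s"
      by (auto intro: mult_dvd_mono)
    then have d: "qfact q m * qfact q n dvd ?br m * qfact q s"
      "qfact q m * qfact q n dvd ?br n * qfact q s"
      unfolding mn qfact_Suc by (simp_all only: ac_simps)
    have "qfact q (m + n) = ?br (m + n) * qfact q s"
      using Suc.hyps(2) qfact_Suc[of q s] by metis
    also have "\<dots> = ?br m * qfact q s + q ^ m * (?br n * qfact q s)"
      by (simp only: sum_power_add) (simp only: algebra_simps)
    finally show ?thesis
      using d by (simp add: dvd_add dvd_mult)
  qed
qed

lemma qbinomial_exact: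
  fixes q :: "'a::idom_divide"
  assumes "k \<le> n"
  shows "qbinomial q n k * (qfact q k * qfact q (n - k)) = qfact q n"
proof -
  let ?d = "qfact q k * qfact q (n - k)"
  obtain c where c: "qfact q n = ?d * c"
    using qfact_mult_dvd[of q k "n - k"] assms by (auto elim: dvdE)
  show ?thesis
    by (cases "?d = 0") (auto simp: qbinomial_def c)
qed

text \<open>The indeterminates of \<open>\<int>[p, q]\<close>, realised as \<open>\<int>[p][q]\<close>.\<close>

definition P :: "int poly poly" where "P = [:[:0, 1:]:]"
definition Q :: "int poly poly" where "Q = [:0, 1:]"

end

theory Submission
  imports Defs
begin

text \<open>
  Cut the permutation matrix of \<open>\<pi>\<close> after position \<open>b\<close> and after value \<open>a\<close>, and let \<open>j\<close> be the
  number of points in the block of small positions and small values. The other blocks then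
  contain \<open>b - j\<close> points (small positions, large values), \<open>a - j\<close> points (large positions, small
  values) and \<open>k = n - a + j\<close> points (large positions, large values). Comparing \<open>\<sigma>\<close> and \<open>\<tau>\<close> on the first
  block shows that \<open>j \<in> J \<sigma> \<tau>\<close> (\<open>Sym_restr_blocks\<close>), and this is the only compatibility
  condition: for such a \<open>j\<close>, the permutation \<open>\<pi>\<close> amounts to the pattern \<open>\<theta>\<close> of its large values,
  which must begin with the pattern of the values of \<open>\<tau>\<close> above \<open>j\<close>, and to its suffix, an
  arbitrary shuffle of \<open>\<sigma>\<^sub>j\<^sub>+\<^sub>1\<dots>\<sigma>\<^sub>a\<close> with the \<open>k\<close> remaining large letters
  (\<open>bij_betw_Sym_restr_fibre\<close>).

  Both statistics are then governed by the theorem of Garsia and Gessel for two words of which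
  one has only smaller letters than the other: over all shuffles of \<open>\<alpha>\<close> and \<open>\<beta>\<close>, the sum of
  \<open>q\<close> to the power \<open>maj\<close> is \<open>q\<close> to the power \<open>maj \<alpha> + maj \<beta>\<close> times a Gaussian
  binomial coefficient (\<open>sum_shuffles_maj\<close>). Applied to the suffixes, it gives the factor in \<open>q\<close>. For the
  factor in \<open>p\<close>, pass to inverses: \<open>imaj \<theta>\<close> is \<open>maj\<close> of the inverse, and prescribing
  the pattern of a prefix of \<open>\<theta>\<close> says that the inverse is a shuffle of a prescribed word with larger
  letters (\<open>sum_fibre_prefix\<close>). What remains is the pattern of the \<open>k\<close> points in the last
  block, and it ranges over all permutations of size \<open>k\<close>; this is the factor \<open>A k p q\<close>.

  The argument works over every commutative semiring (\<open>Sym_restr_gf\<close>). The identity between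
  polynomials is the case of the two indeterminates, and the count is the case \<open>p = q = 1\<close> in
  \<^typ>\<open>nat\<close>.
\<close>

section \<open>Gaussian binomial coefficients\<close>

text \<open>
  \<open>gauss q s k\<close> is the Gaussian binomial coefficient \<open>s + k\<close> over \<open>k\<close>. It is defined by the
  \<open>q\<close>-Pascal recurrence, without division, so that one generating function over an arbitrary
  commutative semiring specialises both to polynomials in \<open>p, q\<close> and to counting in \<^typ>\<open>nat\<close>.
  Indexing by the two part sizes \<open>s\<close> and \<open>k\<close> matches its use for shuffles of words of these
  lengths.
\<close>

fun gauss :: "'a::comm_semiring_1 \<Rightarrow> nat \<Rightarrow> nat \<Rightarrow> 'a" where
  "gauss q 0 k = 1"
| "gauss q (Suc s) 0 = 1"
| "gauss q (Suc s) (Suc k) = gauss q (Suc s) k + q ^ Suc k * gauss q s (Suc k)"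

lemma gauss_0_right [simp]: "gauss q s 0 = 1"
  by (cases s) auto

text \<open>
  This is the defining recurrence with the roles of \<open>s\<close> and \<open>k\<close> exchanged. Both forms occur
  below, according to whether two letters form a descent. For the proof, expand both terms of the
  defining recurrence by this one for smaller \<open>s + k\<close> and regroup; in the border cases
  \<open>s = 0\<close> and \<open>k = 0\<close> only one of the terms is expanded.
\<close>

lemma gauss_Suc_Suc':
  "gauss q (Suc s) (Suc k) = q ^ Suc s * gauss q (Suc s) k + gauss q s (Suc k)"
proof (induction "s + k" arbitrary: s k)
  case 0
  then show ?case by (simp add: add.commute)
next
  case (Suc N)
  show ?case
  proof (cases s; cases k)
    fix k' assume s: "s = 0" and k: "k = Suc k'"
    have 1: "gauss q (Suc 0) (Suc k') = q ^ Suc 0 * gauss q (Suc 0) k' + gauss q 0 (Suc k')"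
      using Suc.hyps(1)[of 0 k'] Suc.hyps(2) s k by simp
    have "gauss q (Suc 0) (Suc k) = (q * gauss q (Suc 0) k' + 1) + q ^ Suc k"
      unfolding gauss.simps(3)[of q 0 k] unfolding k 1 by simp
    also have "\<dots> = q * (gauss q (Suc 0) k' + q ^ Suc k' * gauss q 0 (Suc k')) + 1"
      unfolding k by (simp add: algebra_simps del: gauss.simps(3))
    also have "\<dots> = q * gauss q (Suc 0) k + 1"
      unfolding k gauss.simps(3) ..
    finally show ?thesis unfolding s by simp
  next
    fix s' assume s: "s = Suc s'" and k: "k = 0"
    have 1: "gauss q s (Suc 0) = q ^ s + gauss q s' (Suc 0)"
      using Suc.hyps(1)[of s' 0] Suc.hyps(2) s k by simp
    have "gauss q (Suc s) (Suc 0) = 1 + q * gauss q s (Suc 0)"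
      by simp
    also have "\<dots> = q ^ Suc s + (1 + q * gauss q s' (Suc 0))"
      unfolding 1 by (simp add: algebra_simps)
    also have "1 + q * gauss q s' (Suc 0) = gauss q s (Suc 0)"
      unfolding s by simp
    finally show ?thesis unfolding k by simp
  next
    fix s' k' assume s: "s = Suc s'" and k: "k = Suc k'"
    have 1: "gauss q (Suc s) (Suc k') = q ^ Suc s * gauss q (Suc s) k' + gauss q s (Suc k')"
      using Suc.hyps(1)[of s k'] Suc.hyps(2) s k by (simp del: gauss.simps)
    have 2: "gauss q (Suc s') (Suc k) = q ^ Suc s' * gauss q (Suc s') k + gauss q s' (Suc k)"
      using Suc.hyps(1)[of s' k] Suc.hyps(2) s k by (simp del: gauss.simps)
    have "gauss q (Suc s) (Suc k)
        = (q ^ Suc s * gauss q (Suc s) k' + gauss q s (Suc k'))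
          + q ^ Suc k * (q ^ Suc s' * gauss q (Suc s') k + gauss q s' (Suc k))"
      unfolding gauss.simps(3)[of q s k] using 1 2 s k by (simp del: gauss.simps)
    also have "\<dots> = q ^ Suc s * (gauss q (Suc s) k' + q ^ k * gauss q s k)
        + (gauss q s k + q ^ Suc k * gauss q s' (Suc k))"
      unfolding s k by (simp add: algebra_simps)
    also have "gauss q (Suc s) k' + q ^ k * gauss q s k = gauss q (Suc s) k"
      unfolding k by simp
    also have "gauss q s k + q ^ Suc k * gauss q s' (Suc k) = gauss q s (Suc k)"
      unfolding s by simp
    finally show ?thesis .
  qed (use Suc in simp)
qed

lemma gauss_qfact: "gauss q s k * (qfact q k * qfact q s) = qfact q (s + k)"
proof (induction q s k rule: gauss.induct)
  case (3 q s k)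
  let ?br = "\<lambda>i. \<Sum>j<i. q ^ j"
  have "gauss q (Suc s) (Suc k) * (qfact q (Suc k) * qfact q (Suc s))
     = ?br (Suc k) * (gauss q (Suc s) k * (qfact q k * qfact q (Suc s)))
       + q ^ Suc k * ?br (Suc s) * (gauss q s (Suc k) * (qfact q (Suc k) * qfact q s))"
    unfolding gauss.simps qfact_Suc[of q k] qfact_Suc[of q s] by (simp only: algebra_simps)
  also have "\<dots> = (?br (Suc k) + q ^ Suc k * ?br (Suc s)) * qfact q (Suc (s + k))"
    unfolding 3 by (simp add: algebra_simps)
  also have "?br (Suc k) + q ^ Suc k * ?br (Suc s) = ?br (Suc k + Suc s)"
    by (simp only: sum_power_add)
  also have "\<dots> * qfact q (Suc (s + k)) = qfact q (Suc s + Suc k)"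
    using qfact_Suc[of q "Suc (s + k)"] by (simp add: add.commute)
  finally show ?case .
qed (simp_all add: qfact_def)

lemma qbinomial_eq_gauss:
  assumes "\<And>n. qfact q n \<noteq> 0"
  shows "qbinomial q (s + k) k = gauss q s k"
  unfolding qbinomial_def gauss_qfact[symmetric] using assms by simp

text \<open>
  Cancelling the \<open>q\<close>-factorials is legitimate because they do not vanish: setting both
  indeterminates to 1 turns them into ordinary factorials.
\<close>

lemma qfact_P_nonzero: "qfact P n \<noteq> 0"
proof -
  have "poly (poly (qfact P n) 1) 1 = (\<Prod>i=1..n. int i)"
    by (simp add: qfact_def P_def poly_prod poly_sum)
  then show ?thesis by (auto simp: prod_zero_iff)
qed

lemma qfact_Q_nonzero: "qfact Q n \<noteq> 0"
proof -
  have "poly (poly (qfact Q n) 1) 1 = (\<Prod>i=1..n. int i)"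
    by (simp add: qfact_def Q_def poly_prod poly_sum)
  then show ?thesis by (auto simp: prod_zero_iff)
qed

lemma gauss_one: "gauss (1::nat) s k = (s + k) choose k"
proof (induction "1::nat" s k rule: gauss.induct)
  case (3 s k)
  then show ?case by (simp add: add.commute)
qed simp_all

section \<open>The major index over shuffles of separated words\<close>

lemma maj_Nil [simp]: "maj [] = 0" by (simp add: maj_def)

lemma maj_eq_sum: "maj w = (\<Sum>i = 1..<length w. if w ! (i - 1) > w ! i then i else 0)"
  unfolding maj_def by (rule sum.inter_filter) simp

lemma maj_snoc:
  "maj (w @ [x]) = maj w + (if w \<noteq> [] \<and> last w > x then length w else 0)"
proof (cases "w = []")
  case False
  then have "Suc 0 \<le> length w" by (simp add: Suc_le_eq)
  then have "maj (w @ [x]) =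
      (\<Sum>i = 1..<length w. if (w @ [x]) ! (i - 1) > (w @ [x]) ! i then i else 0)
      + (if last w > x then length w else 0)"
    unfolding maj_eq_sum using False by (simp add: nth_append last_conv_nth)
  also have "(\<Sum>i = 1..<length w. if (w @ [x]) ! (i - 1) > (w @ [x]) ! i then i else 0) = maj w"
    unfolding maj_eq_sum by (rule sum.cong) (auto simp: nth_append)
  finally show ?thesis using False by simp
qed (simp add: maj_def)

text \<open>
  Appending a letter changes \<^const>\<open>maj\<close> in a simple way, so shuffles have to be
  decomposed by their last letter, whereas the recursion equations of \<^const>\<open>shuffles\<close>
  decompose by the first one.
\<close>

lemma shuffles_snoc:
  "shuffles (xs @ [x]) (ys @ [y]) =
     (\<lambda>w. w @ [x]) ` shuffles xs (ys @ [y]) \<union> (\<lambda>w. w @ [y]) ` shuffles (xs @ [x]) ys"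
proof (induction xs ys rule: shuffles.induct)
  case (1 ys)
  show ?case by (induction ys) (auto simp: image_Un image_image)
next
  case (2 xs)
  have "shuffles (xs @ [x]) [y] =
     (\<lambda>w. w @ [x]) ` shuffles xs [y] \<union> {xs @ [x, y]}" for xs
    by (induction xs) (auto simp: image_Un image_image)
  then show ?case by simp
next
  case (3 x' xs y' ys)
  then show ?case by (simp add: image_Un image_image) blast
qed

text \<open>
  A shuffle ends in \<open>x\<close> or in \<open>y\<close>. If that letter exceeds the extra letter \<open>z\<close>, there is a
  descent at the position before \<open>z\<close>, which is the length of the shuffle.
\<close>

lemma sum_shuffles_maj_last:
  fixes q :: "'a::comm_semiring_1"
  assumes "x < y"
  shows "(\<Sum>w\<in>shuffles (\<alpha> @ [x]) (\<beta> @ [y]). q ^ maj (w @ [z]))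
     = q ^ (if x > z then length (\<alpha> @ [x]) + length (\<beta> @ [y]) else 0)
         * (\<Sum>w\<in>shuffles \<alpha> (\<beta> @ [y]). q ^ maj (w @ [x]))
       + q ^ (if y > z then length (\<alpha> @ [x]) + length (\<beta> @ [y]) else 0)
         * (\<Sum>w\<in>shuffles (\<alpha> @ [x]) \<beta>. q ^ maj (w @ [y]))"
proof -
  have *: "(\<Sum>w\<in>(\<lambda>w. w @ [c]) ` shuffles u v. q ^ maj (w @ [z]))
      = q ^ (if c > z then Suc (length u + length v) else 0)
        * (\<Sum>w\<in>shuffles u v. q ^ maj (w @ [c]))" for u v c
    by (subst sum.reindex)
      (auto simp: inj_on_def sum_distrib_left maj_snoc[of "_ @ [c]"] power_add mult.commute
        length_shuffles simp del: append_assoc intro!: sum.cong)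
  have "(\<lambda>w. w @ [x]) ` shuffles \<alpha> (\<beta> @ [y]) \<inter> (\<lambda>w. w @ [y]) ` shuffles (\<alpha> @ [x]) \<beta> = {}"
    using assms by auto
  then show ?thesis
    unfolding shuffles_snoc by (subst sum.union_disjoint) (simp_all add: *)
qed

text \<open>
  Whether appending a letter creates a descent depends on the last letter of the shuffle, so the
  total over all shuffles satisfies no recurrence of its own. Refining by the last letter does: the
  first formula covers the case that the last letter \<open>z\<close> continues the word \<open>\<alpha>\<close> with the
  smaller letters, the second that it continues \<open>\<beta>\<close>. By the preceding lemma each refined sum is a
  combination of one sum of either kind for shorter words. After division by the common power of
  \<open>q\<close> this is the \<open>q\<close>-Pascal rule, in one form if \<open>z\<close> forms a
  descent with the last letter of the word that it continues and in the other form if it does not.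
\<close>

lemma sum_shuffles_maj_snoc:
  fixes q :: "'a::comm_semiring_1"
  shows "\<forall>x\<in>set \<alpha>. \<forall>y\<in>set \<beta>. x < y \<Longrightarrow> \<forall>y\<in>set \<beta>. z < y \<Longrightarrow>
          (\<Sum>w\<in>shuffles \<alpha> \<beta>. q ^ maj (w @ [z]))
          = q ^ (maj (\<alpha> @ [z]) + maj \<beta>) * (q ^ length \<beta> * gauss q (length \<alpha>) (length \<beta>))"
    and "\<forall>x\<in>set \<alpha>. \<forall>y\<in>set \<beta>. x < y \<Longrightarrow> \<forall>x\<in>set \<alpha>. x < z \<Longrightarrow>
          (\<Sum>w\<in>shuffles \<alpha> \<beta>. q ^ maj (w @ [z]))
          = q ^ (maj \<alpha> + maj (\<beta> @ [z])) * gauss q (length \<alpha>) (length \<beta>)"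
proof (induction "length \<alpha> + length \<beta>" arbitrary: \<alpha> \<beta> z rule: less_induct)
  case less
  {
    case 1
    note lt = this
    show ?case
    proof (cases "\<alpha> = [] \<or> \<beta> = []")
      case True
      then show ?thesis
      proof (cases \<beta> rule: rev_cases)
        case Nil
        then show ?thesis by simp
      next
        case (snoc \<beta>' y)
        then have "\<alpha> = []" "last \<beta> > z" "\<beta> \<noteq> []" using True lt by auto
        then show ?thesis by (simp add: maj_snoc[of \<beta>] maj_snoc[of "[]" z, simplified] power_add)
      qed
    next
      case False
      then obtain \<alpha>' x \<beta>' y where s: "\<alpha> = \<alpha>' @ [x]" "\<beta> = \<beta>' @ [y]"
        by (metis rev_exhaust)
      have 1: "(\<Sum>w\<in>shuffles \<alpha>' \<beta>. q ^ maj (w @ [x]))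
         = q ^ (maj \<alpha> + maj \<beta>) * (q ^ length \<beta> * gauss q (length \<alpha>') (length \<beta>))"
        unfolding s(1) by (rule less(1)) (use lt s in auto)
      have 2: "(\<Sum>w\<in>shuffles \<alpha> \<beta>'. q ^ maj (w @ [y]))
         = q ^ (maj \<alpha> + maj \<beta>) * gauss q (length \<alpha>) (length \<beta>')"
        unfolding s(2) by (rule less(2)) (use lt s in auto)
      have last: "\<alpha> \<noteq> []" "last \<alpha> = x" "\<beta> \<noteq> []" "last \<beta> = y" using s by auto
      have len: "length \<alpha> = Suc (length \<alpha>')" "length \<beta> = Suc (length \<beta>')" using s by auto
      have c: "x < y" "z < y" using lt s by auto
      have "(\<Sum>w\<in>shuffles \<alpha> \<beta>. q ^ maj (w @ [z]))
         = q ^ (maj \<alpha> + maj \<beta>) * (q ^ length \<beta> *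
             (q ^ (if x > z then length \<alpha> + length \<beta> else 0) * gauss q (length \<alpha>') (length \<beta>)
              + q ^ length \<alpha> * gauss q (length \<alpha>) (length \<beta>')))"
        using sum_shuffles_maj_last[OF c(1), of q z \<alpha>' \<beta>'] unfolding s[symmetric] 1 2 if_P[OF c(2)]
        by (simp add: algebra_simps power_add split del: if_split)
      also have "q ^ (if x > z then length \<alpha> + length \<beta> else 0) * gauss q (length \<alpha>') (length \<beta>)
              + q ^ length \<alpha> * gauss q (length \<alpha>) (length \<beta>')
          = q ^ (if x > z then length \<alpha> else 0) * gauss q (length \<alpha>) (length \<beta>)"
      proof (cases "x > z")
        case True
        then show ?thesis
          unfolding len gauss.simps(3) by (simp add: algebra_simps power_add)
      next
        case False
        then show ?thesis
          unfolding len gauss_Suc_Suc' by (simp add: algebra_simps)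
      qed
      finally show ?thesis
        using maj_snoc[of \<alpha> z] last by (simp add: power_add mult.assoc mult.left_commute)
    qed
  next
    case 2
    note lt = this
    show ?case
    proof (cases "\<alpha> = [] \<or> \<beta> = []")
      case True
      then show ?thesis
      proof (cases \<alpha> rule: rev_cases)
        case Nil
        then show ?thesis by simp
      next
        case (snoc \<alpha>' y)
        then have "\<beta> = []" "last \<alpha> < z" "\<alpha> \<noteq> []" using True lt by auto
        then show ?thesis by (simp add: maj_snoc[of \<alpha>] maj_snoc[of "[]" z, simplified])
      qed
    next
      case False
      then obtain \<alpha>' x \<beta>' y where s: "\<alpha> = \<alpha>' @ [x]" "\<beta> = \<beta>' @ [y]"
        by (metis rev_exhaust)
      have 1: "(\<Sum>w\<in>shuffles \<alpha>' \<beta>. q ^ maj (w @ [x]))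
         = q ^ (maj \<alpha> + maj \<beta>) * (q ^ length \<beta> * gauss q (length \<alpha>') (length \<beta>))"
        unfolding s(1) by (rule less(1)) (use lt s in auto)
      have 2: "(\<Sum>w\<in>shuffles \<alpha> \<beta>'. q ^ maj (w @ [y]))
         = q ^ (maj \<alpha> + maj \<beta>) * gauss q (length \<alpha>) (length \<beta>')"
        unfolding s(2) by (rule less(2)) (use lt s in auto)
      have last: "\<alpha> \<noteq> []" "last \<alpha> = x" "\<beta> \<noteq> []" "last \<beta> = y" using s by auto
      have len: "length \<alpha> = Suc (length \<alpha>')" "length \<beta> = Suc (length \<beta>')" using s by auto
      have c: "x < y" "\<not> x > z" using lt s by auto
      have "(\<Sum>w\<in>shuffles \<alpha> \<beta>. q ^ maj (w @ [z]))
         = q ^ (maj \<alpha> + maj \<beta>) *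
             (q ^ length \<beta> * gauss q (length \<alpha>') (length \<beta>)
              + q ^ (if y > z then length \<alpha> + length \<beta> else 0) * gauss q (length \<alpha>) (length \<beta>'))"
        using sum_shuffles_maj_last[OF c(1), of q z \<alpha>' \<beta>'] unfolding s[symmetric] 1 2 if_not_P[OF c(2)]
        by (simp add: algebra_simps power_add split del: if_split)
      also have "q ^ length \<beta> * gauss q (length \<alpha>') (length \<beta>)
              + q ^ (if y > z then length \<alpha> + length \<beta> else 0) * gauss q (length \<alpha>) (length \<beta>')
          = q ^ (if y > z then length \<beta> else 0) * gauss q (length \<alpha>) (length \<beta>)"
      proof (cases "y > z")
        case True
        then show ?thesis
          unfolding len gauss_Suc_Suc' by (simp add: algebra_simps power_add)
      next
        case False
        then show ?thesis
          unfolding len gauss.simps(3) by (simp add: algebra_simps)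
      qed
      finally show ?thesis
        using maj_snoc[of \<beta> z] last by (simp add: power_add mult.assoc mult.left_commute)
    qed
  }
qed

text \<open>
  The theorem of Garsia and Gessel on \<^const>\<open>maj\<close> over shuffles, when one word has only
  smaller letters than the other. An additional last letter \<open>z\<close> that is larger than
  all others creates no descent, which reduces the statement to the second refined sum.
\<close>

lemma sum_shuffles_maj:
  fixes q :: "'a::comm_semiring_1"
  assumes "\<forall>x\<in>set \<alpha>. \<forall>y\<in>set \<beta>. x < y"
  shows "(\<Sum>w\<in>shuffles \<alpha> \<beta>. q ^ maj w)
          = q ^ (maj \<alpha> + maj \<beta>) * gauss q (length \<alpha>) (length \<beta>)"
proof -
  define z where "z = Suc (Max (insert 0 (set \<alpha> \<union> set \<beta>)))"
  have z: "x < z" if "x \<in> set \<alpha> \<union> set \<beta>" for x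
    unfolding z_def less_Suc_eq_le using that by (intro Max_ge) auto
  have maj_z: "maj (w @ [z]) = maj w" if "set w \<subseteq> set \<alpha> \<union> set \<beta>" for w
  proof -
    have "w \<noteq> [] \<Longrightarrow> last w < z"
      using z that last_in_set by blast
    then show ?thesis using maj_snoc[of "[]" z] by (auto simp: maj_snoc)
  qed
  have "(\<Sum>w\<in>shuffles \<alpha> \<beta>. q ^ maj w) = (\<Sum>w\<in>shuffles \<alpha> \<beta>. q ^ maj (w @ [z]))"
    by (intro sum.cong) (simp_all add: maj_z set_shuffles)
  also have "\<dots> = q ^ (maj \<alpha> + maj \<beta>) * gauss q (length \<alpha>) (length \<beta>)"
    using sum_shuffles_maj_snoc(2)[of \<alpha> \<beta> z q] assms z by (simp add: maj_z)
  finally show ?thesis .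
qed

section \<open>Standardization of words\<close>

definition rank :: "nat set \<Rightarrow> nat \<Rightarrow> nat" where
  "rank X x = card {y \<in> X. y \<le> x}"

lemma standardize_rank: "standardize w = map (rank (set w)) w"
  by (simp add: standardize_def rank_def)

lemma rank_less:
  assumes "finite X" "y \<in> X" "x < y"
  shows "rank X x < rank X y"
proof -
  have "y \<in> {t \<in> X. t \<le> y}" "y \<notin> {t \<in> X. t \<le> x}" "{t \<in> X. t \<le> x} \<subseteq> {t \<in> X. t \<le> y}"
    using assms by auto
  then have "{t \<in> X. t \<le> x} \<subset> {t \<in> X. t \<le> y}" by blast
  then show ?thesis
    unfolding rank_def by (rule psubset_card_mono[rotated]) (use assms in simp)
qed

lemma rank_strict_mono: "finite X \<Longrightarrow> strict_mono_on X (rank X)"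
  by (intro strict_mono_onI) (simp add: rank_less)

lemma rank_inj: "finite X \<Longrightarrow> inj_on (rank X) X"
  by (rule strict_mono_on_imp_inj_on[OF rank_strict_mono])

lemma rank_image: "finite X \<Longrightarrow> rank X ` X = {1..card X}"
proof (rule card_subset_eq)
  assume X: "finite X"
  have "rank X x \<ge> 1" "rank X x \<le> card X" if "x \<in> X" for x
    using X that by (auto simp: rank_def Suc_le_eq card_gt_0_iff intro!: card_mono)
  then show "rank X ` X \<subseteq> {1..card X}" by auto
  show "card (rank X ` X) = card {1..card X}"
    using X by (simp add: card_image rank_inj)
qed simp

lemma standardize_in_Sym:
  assumes "distinct w"
  shows "standardize w \<in> Sym (length w)"
  using assms unfolding standardize_rank permutations_of_set_def
  by (simp add: distinct_map rank_inj rank_image distinct_card)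

lemma length_standardize [simp]: "length (standardize w) = length w"
  by (simp add: standardize_def)

lemma standardize_map:
  assumes "strict_mono_on (set w) f"
  shows "standardize (map f w) = standardize w"
proof -
  have "card {y \<in> f ` set w. y \<le> f x} = card {y \<in> set w. y \<le> x}" if "x \<in> set w" for x
  proof -
    have "{y \<in> f ` set w. y \<le> f x} = f ` {y \<in> set w. y \<le> x}"
      using assms that by (auto simp: strict_mono_on_leD strict_mono_on_less_eq)
    moreover have "inj_on f {y \<in> set w. y \<le> x}"
      using strict_mono_on_imp_inj_on[OF assms] by (rule inj_on_subset) auto
    ultimately show ?thesis by (simp add: card_image)
  qed
  then show ?thesis by (simp add: standardize_def)
qed

lemma length_Sym: "w \<in> Sym N \<Longrightarrow> length w = N"
  by (simp add: length_finite_permutations_of_set)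

lemma standardize_Sym:
  assumes "w \<in> Sym N"
  shows "standardize w = w"
proof -
  have "card {y \<in> {1..N}. y \<le> x} = x" if "x \<in> {1..N}" for x
  proof -
    have "{y \<in> {1..N}. y \<le> x} = {1..x}" using that by auto
    then show ?thesis by simp
  qed
  then show ?thesis
    using assms by (auto simp: standardize_def permutations_of_set_def intro!: map_idI)
qed

text \<open>
  A word is determined by its pattern and its letters. In the bijections below, words are
  identified in this way.
\<close>

lemma standardize_inject:
  assumes "standardize u = standardize w" and "set u = set w"
  shows "u = w"
  by (rule map_inj_on[of "rank (set w)"]) (use assms in \<open>simp_all add: standardize_rank rank_inj\<close>)

lemma ex_word_standardize:
  assumes "\<tau> \<in> Sym (card X)" and "finite X"
  shows "\<exists>u. distinct u \<and> set u = X \<and> standardize u = \<tau>"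
proof -
  define f where "f = inv_into X (rank X)"
  have b: "bij_betw f {1..card X} X"
    unfolding f_def using rank_inj rank_image assms(2)
    by (intro bij_betw_inv_into) (auto simp: bij_betw_def)
  have \<tau>: "set \<tau> = {1..card X}" "distinct \<tau>"
    using assms by (auto simp: permutations_of_set_def)
  have s: "set (map f \<tau>) = X" using b \<tau> by (simp add: bij_betw_def)
  have "map (rank X) (map f \<tau>) = \<tau>"
    unfolding f_def using \<tau> rank_image[OF assms(2)]
    by (auto simp: f_inv_into_f intro!: map_idI)
  moreover have "distinct (map f \<tau>)"
    using b \<tau> by (simp add: distinct_map bij_betw_def)
  ultimately show ?thesis using s by (metis standardize_rank)
qed

lemma rank_le_iff:
  assumes "finite X" "x \<in> X"
  shows "rank X x \<le> card {y \<in> X. y \<le> c} \<longleftrightarrow> x \<le> c"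
proof
  assume "x \<le> c"
  then show "rank X x \<le> card {y \<in> X. y \<le> c}"
    unfolding rank_def using assms by (intro card_mono) auto
next
  assume *: "rank X x \<le> card {y \<in> X. y \<le> c}"
  show "x \<le> c"
  proof (rule ccontr)
    assume "\<not> x \<le> c"
    then have "{y \<in> X. y \<le> c} \<subset> {y \<in> X. y \<le> x}" using assms by auto
    then have "card {y \<in> X. y \<le> c} < rank X x"
      unfolding rank_def using assms by (intro psubset_card_mono) auto
    with * show False by simp
  qed
qed

text \<open>
  Ranking the letters of \<open>u\<close> sends exactly the letters \<open>x \<le> c\<close> to the ranks up to \<open>j\<close>, so
  cutting by value commutes with standardization.
\<close>

lemma standardize_filter_standardize:
  fixes c :: nat
  assumes "j = card {x \<in> set u. x \<le> c}"
  shows "values_le (standardize u) j = standardize (filter (\<lambda>x. x \<le> c) u)"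
    and "values_gt (standardize u) j = standardize (filter (\<lambda>x. x > c) u)"
proof -
  have *: "standardize (filter Q (standardize u)) = standardize (filter R u)"
    if "\<And>x. x \<in> set u \<Longrightarrow> Q (rank (set u) x) \<longleftrightarrow> R x" for Q R
  proof -
    have "filter Q (standardize u) = map (rank (set u)) (filter R u)"
      unfolding standardize_rank filter_map using that by (auto cong: filter_cong)
    then show ?thesis
      using standardize_map[of "filter R u" "rank (set u)"]
        monotone_on_subset[OF rank_strict_mono[of "set u"], of "set (filter R u)"] by simp
  qed
  show "values_le (standardize u) j = standardize (filter (\<lambda>x. x \<le> c) u)"
    unfolding values_le_def assms by (rule *) (simp add: rank_le_iff)
  show "values_gt (standardize u) j = standardize (filter (\<lambda>x. x > c) u)"
    unfolding values_gt_def assms using rank_le_iff[of "set u" _ c]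
    by (intro *) (simp flip: not_le)
qed

lemma maj_map:
  assumes "strict_mono_on (set w) f"
  shows "maj (map f w) = maj w"
proof -
  have "f (w ! i) < f (w ! j) \<longleftrightarrow> w ! i < w ! j" if "i < length w" "j < length w" for i j
    using assms that by (simp add: strict_mono_on_less)
  then have "{i \<in> {1..<length w}. map f w ! (i - 1) > map f w ! i}
      = {i \<in> {1..<length w}. w ! (i - 1) > w ! i}"
    by auto
  then show ?thesis by (simp add: maj_def)
qed

lemma maj_standardize: "maj (standardize w) = maj w"
  by (simp add: standardize_rank maj_map rank_strict_mono)

text \<open>
  When a threshold \<open>c\<close> separates the letters of two words, a word is a shuffle of them iff its
  letters on the two sides of \<open>c\<close> spell these words. This is how membership in the fibres of the
  bijections below is decided.
\<close>

lemma shuffles_eq_filter: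
  fixes c :: nat
  assumes "\<forall>x\<in>set \<alpha>. x \<le> c" "\<forall>y\<in>set \<beta>. c < y"
  shows "shuffles \<alpha> \<beta> = {w. filter (\<lambda>x. x \<le> c) w = \<alpha> \<and> filter (\<lambda>x. x > c) w = \<beta>}"
proof (intro set_eqI iffI)
  fix w assume w: "w \<in> shuffles \<alpha> \<beta>"
  have d: "set \<alpha> \<inter> set \<beta> = {}" using assms by fastforce
  have "filter (\<lambda>x. x \<le> c) w = filter (\<lambda>x. x \<in> set \<alpha>) w"
       "filter (\<lambda>x. x > c) w = filter (\<lambda>x. x \<notin> set \<alpha>) w"
    using assms set_shuffles[OF w] by (intro filter_cong; force)+
  then show "w \<in> {w. filter (\<lambda>x. x \<le> c) w = \<alpha> \<and> filter (\<lambda>x. x > c) w = \<beta>}"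
    using filter_shuffles_disjoint1[OF d w] by simp
next
  fix w assume "w \<in> {w. filter (\<lambda>x. x \<le> c) w = \<alpha> \<and> filter (\<lambda>x. x > c) w = \<beta>}"
  then show "w \<in> shuffles \<alpha> \<beta>"
    using partition_in_shuffles[of w "\<lambda>x. x \<le> c"] by (auto simp: not_le)
qed

section \<open>Inverse permutations\<close>

definition pos :: "nat list \<Rightarrow> nat \<Rightarrow> nat" where
  "pos w = inv_into {1..length w} (\<lambda>i. w ! (i - 1))"

lemma perm_inverse_pos: "w \<in> Sym N \<Longrightarrow> perm_inverse w = map (pos w) [1..<N + 1]"
  by (simp add: perm_inverse_def pos_def length_Sym)

lemma nth_bij:
  assumes "distinct w"
  shows "bij_betw (\<lambda>i. w ! (i - 1)) {1..length w} (set w)"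
proof -
  have "bij_betw (\<lambda>i. i - 1) {1..length w} {..<length w}"
    by (rule bij_betw_byWitness[of _ Suc]) auto
  from bij_betw_trans[OF this bij_betw_nth[OF assms refl refl]] show ?thesis
    by (simp add: o_def)
qed

lemma pos_bij: "distinct w \<Longrightarrow> bij_betw (pos w) (set w) {1..length w}"
  unfolding pos_def by (intro bij_betw_inv_into nth_bij)

lemma pos_eqI:
  assumes "distinct w" "i < length w" "w ! i = x"
  shows "pos w x = Suc i"
  unfolding pos_def
  by (rule inv_into_f_eq[OF bij_betw_imp_inj_on[OF nth_bij[OF assms(1)]]]) (use assms in auto)

lemma perm_inverse_Sym:
  assumes "w \<in> Sym N"
  shows "perm_inverse w \<in> Sym N"
proof -
  have w: "set w = {1..N}" "distinct w" "length w = N"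
    using assms by (auto simp: permutations_of_set_def length_Sym)
  have "{1..<N + 1} = {1..N}" by auto
  then show ?thesis
    using pos_bij[OF w(2)] unfolding w perm_inverse_pos[OF assms]
    by (simp add: permutations_of_set_def distinct_map bij_betw_def del: upt_Suc)
qed

lemma perm_inverse_inverse:
  assumes "w \<in> Sym N"
  shows "perm_inverse (perm_inverse w) = w"
proof (rule nth_equalityI)
  have v: "perm_inverse w \<in> Sym N" using assms by (rule perm_inverse_Sym)
  have d: "distinct (perm_inverse w)" using v by (auto simp: permutations_of_set_def)
  have dw: "distinct w" "set w = {1..N}" using assms by (auto simp: permutations_of_set_def)
  show "length (perm_inverse (perm_inverse w)) = length w"
    using length_Sym[OF perm_inverse_Sym[OF v]] length_Sym[OF assms] by simp
  fix i assume "i < length (perm_inverse (perm_inverse w))"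
  then have i: "i < N" "i < length w"
    using length_Sym[OF perm_inverse_Sym[OF v]] length_Sym[OF assms] by simp_all
  have wi: "w ! i \<in> {1..N}" using dw i nth_mem by metis
  have "pos (perm_inverse w) (i + 1) = Suc (w ! i - 1)"
  proof (rule pos_eqI[OF d])
    show "w ! i - 1 < length (perm_inverse w)" using wi length_Sym[OF v] by auto
    have "perm_inverse w ! (w ! i - 1) = pos w (w ! i)"
      using wi by (subst perm_inverse_pos[OF assms]) (auto simp del: upt_Suc)
    also have "\<dots> = Suc i" by (rule pos_eqI) (use dw i in auto)
    finally show "perm_inverse w ! (w ! i - 1) = i + 1" by simp
  qed
  then show "perm_inverse (perm_inverse w) ! i = w ! i"
    using i wi by (simp add: perm_inverse_pos[OF v] del: upt_Suc)
qed

lemma perm_inverse_bij: "bij_betw perm_inverse (Sym N) (Sym N)"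
  by (rule bij_betw_byWitness[of _ perm_inverse])
    (intro ballI image_subsetI perm_inverse_inverse perm_inverse_Sym; assumption)+

text \<open>
  Standardization relabels the letters in increasing order, so the inverse lists the
  positions of the letters of \<open>w\<close> from the smallest letter to the largest.
\<close>

lemma perm_inverse_standardize:
  assumes "distinct w"
  shows "perm_inverse (standardize w) = map (pos w) (sorted_list_of_set (set w))"
proof -
  let ?X = "set w"
  have ranks: "map (rank ?X) (sorted_list_of_set ?X) = [1..<length w + 1]"
  proof (rule sorted_distinct_set_unique)
    show "sorted (map (rank ?X) (sorted_list_of_set ?X))"
      unfolding sorted_map
      by (rule sorted_wrt_mono_rel[of _ "(\<le>)"])
        (auto simp: strict_mono_on_leD[OF rank_strict_mono])
    show "distinct (map (rank ?X) (sorted_list_of_set ?X))"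
      by (simp add: distinct_map rank_inj)
    show "set (map (rank ?X) (sorted_list_of_set ?X)) = set [1..<length w + 1]"
      using rank_image[of ?X] distinct_card[OF assms] by auto
  qed (simp_all del: upt_Suc)
  have "perm_inverse (standardize w)
      = map (pos (standardize w)) (map (rank ?X) (sorted_list_of_set ?X))"
    unfolding ranks by (rule perm_inverse_pos[OF standardize_in_Sym[OF assms]])
  also have "\<dots> = map (\<lambda>x. pos (standardize w) (rank ?X x)) (sorted_list_of_set ?X)"
    by simp
  also have "\<dots> = map (pos w) (sorted_list_of_set ?X)"
  proof (rule map_cong[OF refl])
    fix x assume "x \<in> set (sorted_list_of_set ?X)"
    then obtain i where i: "i < length w" "w ! i = x" by (auto simp: in_set_conv_nth)
    have "distinct (standardize w)"
      using standardize_in_Sym[OF assms] by (auto simp: permutations_of_set_def)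
    then have "pos (standardize w) (rank ?X x) = Suc i"
      using i by (intro pos_eqI) (auto simp: standardize_rank)
    with pos_eqI[OF assms i] show "pos (standardize w) (rank ?X x) = pos w x" by simp
  qed
  finally show ?thesis .
qed

lemma filter_sorted_list_of_set:
  "finite X \<Longrightarrow> filter R (sorted_list_of_set X) = sorted_list_of_set {x \<in> X. R x}"
  by (rule sorted_distinct_set_unique) (simp_all add: sorted_wrt_filter)

text \<open>
  Inversion exchanges positions and values. It therefore turns cutting a permutation after
  its first \<open>s\<close> positions into cutting its inverse at the value \<open>s\<close>.
\<close>

lemma perm_inverse_split:
  assumes "w \<in> Sym N" "s \<le> N"
  shows "filter (\<lambda>x. x \<le> s) (perm_inverse w) = perm_inverse (prefix_le w s)"
    and "filter (\<lambda>x. x > s) (perm_inverse w) = map ((+) s) (perm_inverse (suffix_gt w s))"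
proof -
  define u v where "u = take s w" and "v = drop s w"
  have w: "w = u @ v" by (simp add: u_def v_def)
  have lu: "length u = s" using assms by (simp add: u_def length_Sym)
  have d: "distinct (u @ v)" using assms w by (auto simp: permutations_of_set_def)
  have pu: "pos w x = pos u x" "pos w x \<le> s" if x: "x \<in> set u" for x
  proof -
    obtain i where i: "i < length u" "u ! i = x" using x by (auto simp: in_set_conv_nth)
    have "pos w x = Suc i" unfolding w using d i by (intro pos_eqI) (auto simp: nth_append)
    moreover have "pos u x = Suc i" using d i by (intro pos_eqI) auto
    ultimately show "pos w x = pos u x" "pos w x \<le> s" using i lu by auto
  qed
  have pv: "pos w x = s + pos v x" "pos w x > s" if x: "x \<in> set v" for x
  proof -
    obtain i where i: "i < length v" "v ! i = x" using x by (auto simp: in_set_conv_nth)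
    have "pos w x = Suc (s + i)" unfolding w using d i lu by (intro pos_eqI) (auto simp: nth_append)
    moreover have "pos v x = Suc i" using d i by (intro pos_eqI) auto
    ultimately show "pos w x = s + pos v x" "pos w x > s" by auto
  qed
  have i: "perm_inverse w = map (pos w) (sorted_list_of_set (set w))"
    using perm_inverse_standardize[of w] assms standardize_Sym d w by metis
  have "{x \<in> set w. pos w x \<le> s} = set u" "{x \<in> set w. pos w x > s} = set v"
    using pu(2) pv(2) unfolding w by fastforce+
  then have "filter (\<lambda>x. x \<le> s) (perm_inverse w) = map (pos w) (sorted_list_of_set (set u))"
    and "filter (\<lambda>x. x > s) (perm_inverse w) = map (pos w) (sorted_list_of_set (set v))"
    unfolding i by (simp_all add: filter_map o_def filter_sorted_list_of_set)
  then show "filter (\<lambda>x. x \<le> s) (perm_inverse w) = perm_inverse (prefix_le w s)"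
    and "filter (\<lambda>x. x > s) (perm_inverse w) = map ((+) s) (perm_inverse (suffix_gt w s))"
    using pu pv d by (simp_all add: prefix_le_def suffix_gt_def perm_inverse_standardize
        flip: u_def v_def)
qed

section \<open>Permutations with a prescribed prefix pattern\<close>

text \<open>
  Inversion exchanges \<^const>\<open>maj\<close> and \<^const>\<open>imaj\<close>.
\<close>

lemma A_swap: "A k q p = A k p (q::'a::comm_semiring_1)"
proof -
  have "A k q p = (\<Sum>\<pi>\<in>Sym k. q ^ imaj (perm_inverse \<pi>) * p ^ maj (perm_inverse \<pi>))"
    unfolding A_def by (rule sum.reindex_bij_betw[OF perm_inverse_bij, symmetric])
  also have "\<dots> = A k p q"
    unfolding A_def
    by (rule sum.cong[OF refl]) (subst mult.commute, simp only: imaj_def perm_inverse_inverse)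
  finally show ?thesis .
qed

text \<open>
  Sending \<open>\<theta>\<close> to its inverse \<open>w\<close>, together with the inverse \<open>\<rho>\<close> of its suffix pattern, turns
  the permutations with prefix pattern \<open>\<alpha>\<close> into the shuffles of the inverse of \<open>\<alpha>\<close> with a
  copy of \<open>\<rho>\<close> shifted up by \<open>s\<close>. There \<open>imaj \<theta>\<close> becomes \<open>maj w\<close>, and the shuffle theorem applies for
  each fixed \<open>\<rho>\<close>.
\<close>

lemma sum_fibre_prefix:
  fixes p q :: "'a::comm_semiring_1"
  assumes "\<alpha> \<in> Sym s"
  shows "(\<Sum>\<theta>\<in>{\<theta> \<in> Sym (s + k). prefix_le \<theta> s = \<alpha>}. p ^ imaj \<theta> * q ^ maj (suffix_gt \<theta> s))
    = p ^ imaj \<alpha> * gauss p s k * A k p q"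
proof -
  define B where "B = perm_inverse \<alpha>"
  have B: "B \<in> Sym s" unfolding B_def using assms by (rule perm_inverse_Sym)
  let ?S = "{\<theta> \<in> Sym (s + k). prefix_le \<theta> s = \<alpha>}"
  let ?T = "SIGMA \<rho>:Sym k. shuffles B (map ((+) s) \<rho>)"
  have sh: "shuffles B (map ((+) s) \<rho>)
      = {w. filter (\<lambda>x. x \<le> s) w = B \<and> filter (\<lambda>x. x > s) w = map ((+) s) \<rho>}"
    if "\<rho> \<in> Sym k" for \<rho>
    using B that by (intro shuffles_eq_filter) (auto simp: permutations_of_set_def)
  have suf: "suffix_gt \<theta> s \<in> Sym k" if "\<theta> \<in> Sym (s + k)" for \<theta>
    using standardize_in_Sym[of "drop s \<theta>"] that
    by (auto simp: suffix_gt_def permutations_of_set_def length_Sym[OF that])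
  have pre: "prefix_le \<theta> s \<in> Sym s" if "\<theta> \<in> Sym (s + k)" for \<theta>
    using standardize_in_Sym[of "take s \<theta>"] that
    by (auto simp: prefix_le_def permutations_of_set_def length_Sym[OF that])
  have "(\<Sum>\<theta>\<in>?S. p ^ imaj \<theta> * q ^ maj (suffix_gt \<theta> s))
     = (\<Sum>(\<rho>, w)\<in>?T. p ^ maj w * q ^ imaj \<rho>)"
  proof (rule sum.reindex_bij_witness[of _ "\<lambda>(\<rho>, w). perm_inverse w"
        "\<lambda>\<theta>. (perm_inverse (suffix_gt \<theta> s), perm_inverse \<theta>)"])
    fix \<theta> assume \<theta>: "\<theta> \<in> ?S"
    then have t: "\<theta> \<in> Sym (s + k)" "prefix_le \<theta> s = \<alpha>" by auto
    note split = perm_inverse_split[OF t(1), of s]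
    show "(perm_inverse (suffix_gt \<theta> s), perm_inverse \<theta>) \<in> ?T"
      using split t(2) perm_inverse_Sym[OF suf[OF t(1)]] sh[OF perm_inverse_Sym[OF suf[OF t(1)]]]
      by (simp add: B_def)
    show "(case (perm_inverse (suffix_gt \<theta> s), perm_inverse \<theta>) of (\<rho>, w) \<Rightarrow> perm_inverse w) = \<theta>"
      using perm_inverse_inverse[OF t(1)] by simp
    show "(case (perm_inverse (suffix_gt \<theta> s), perm_inverse \<theta>) of (\<rho>, w) \<Rightarrow> p ^ maj w * q ^ imaj \<rho>)
        = p ^ imaj \<theta> * q ^ maj (suffix_gt \<theta> s)"
      using perm_inverse_inverse[OF suf[OF t(1)]] by (simp add: imaj_def)
  next
    fix x assume x: "x \<in> ?T"
    obtain \<rho> w where xw: "x = (\<rho>, w)" by force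
    have \<rho>: "\<rho> \<in> Sym k" and w: "w \<in> shuffles B (map ((+) s) \<rho>)" using x xw by auto
    have "distinct w" "set w = {1..s} \<union> (+) s ` {1..k}"
      using w \<rho> B distinct_disjoint_shuffles[OF _ _ _ w] set_shuffles[OF w]
      by (auto simp: permutations_of_set_def distinct_map)
    moreover have "{1..s} \<union> (+) s ` {1..k} = {1..s + k}"
      by auto
    ultimately have wS: "w \<in> Sym (s + k)" by (simp add: permutations_of_set_def)
    define \<theta> where "\<theta> = perm_inverse w"
    have t: "\<theta> \<in> Sym (s + k)" and w\<theta>: "w = perm_inverse \<theta>"
      unfolding \<theta>_def using wS by (simp_all only: perm_inverse_Sym perm_inverse_inverse)
    note split = perm_inverse_split[OF t, of s]
    have B\<theta>: "perm_inverse (prefix_le \<theta> s) = B"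
      and \<rho>\<theta>: "map ((+) s) (perm_inverse (suffix_gt \<theta> s)) = map ((+) s) \<rho>"
      using split w unfolding sh[OF \<rho>] w\<theta> by auto
    have "prefix_le \<theta> s = perm_inverse B"
      using perm_inverse_inverse[OF pre[OF t]] unfolding B\<theta> by simp
    also have "\<dots> = \<alpha>" unfolding B_def by (rule perm_inverse_inverse[OF assms])
    finally have 1: "prefix_le \<theta> s = \<alpha>" .
    have 2: "perm_inverse (suffix_gt \<theta> s) = \<rho>"
      using \<rho>\<theta> by (rule map_injective) (simp add: inj_on_def)
    show "(case x of (\<rho>, w) \<Rightarrow> perm_inverse w) \<in> ?S"
      using t 1 by (simp add: xw flip: \<theta>_def)
    show "(perm_inverse (suffix_gt (case x of (\<rho>, w) \<Rightarrow> perm_inverse w) s),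
        perm_inverse (case x of (\<rho>, w) \<Rightarrow> perm_inverse w)) = x"
      using 2 w\<theta>[symmetric] by (simp add: xw flip: \<theta>_def)
  qed
  also have "\<dots> = (\<Sum>\<rho>\<in>Sym k. q ^ imaj \<rho> * (\<Sum>w\<in>shuffles B (map ((+) s) \<rho>). p ^ maj w))"
    by (subst sum.Sigma[symmetric]) (simp_all add: sum_distrib_left mult.commute)
  also have "\<dots> = (\<Sum>\<rho>\<in>Sym k. p ^ maj B * gauss p s k * (q ^ imaj \<rho> * p ^ maj \<rho>))"
  proof (rule sum.cong[OF refl])
    fix \<rho> assume \<rho>: "\<rho> \<in> Sym k"
    have "(\<Sum>w\<in>shuffles B (map ((+) s) \<rho>). p ^ maj w) = p ^ (maj B + maj \<rho>) * gauss p s k"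
      using sum_shuffles_maj[of B "map ((+) s) \<rho>" p] B \<rho> length_Sym[OF B] length_Sym[OF \<rho>]
        maj_map[of \<rho> "(+) s"]
      by (auto simp: permutations_of_set_def strict_mono_on_def)
    then show "q ^ imaj \<rho> * (\<Sum>w\<in>shuffles B (map ((+) s) \<rho>). p ^ maj w)
        = p ^ maj B * gauss p s k * (q ^ imaj \<rho> * p ^ maj \<rho>)"
      by (simp add: power_add algebra_simps)
  qed
  also have "\<dots> = p ^ imaj \<alpha> * gauss p s k * A k p q"
    unfolding sum_distrib_left[symmetric] A_swap[of k q p, symmetric]
    by (simp add: A_def imaj_def B_def)
  finally show ?thesis .
qed

section \<open>Permutations with prescribed value and position patterns\<close>

lemma filter_le_Sym:
  assumes "w \<in> Sym (a + m)"
  shows "filter (\<lambda>x. x \<le> a) w \<in> Sym a"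
proof -
  have "{x \<in> {1..a + m}. x \<le> a} = {1..a}" by auto
  then show ?thesis using assms by (simp add: permutations_of_set_def)
qed

lemma filter_gt_Sym:
  assumes "w \<in> Sym (a + m)"
  shows "values_gt w a \<in> Sym m" and "map ((+) a) (values_gt w a) = filter (\<lambda>x. x > a) w"
proof -
  define v where "v = map (\<lambda>x. x - a) (filter (\<lambda>x. x > a) w)"
  have w: "set w = {1..a + m}" "distinct w" using assms by (auto simp: permutations_of_set_def)
  have av: "map ((+) a) v = filter (\<lambda>x. x > a) w"
    by (auto simp: v_def intro!: map_idI)
  have "distinct (map ((+) a) v)" unfolding av using w by simp
  then have "distinct v" by (simp add: distinct_map)
  moreover have "set v = {1..m}"
  proof -
    have "{x \<in> {1..a + m}. x > a} = (+) a ` {1..m}" by auto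
    then have "set v = (\<lambda>x. x - a) ` (+) a ` {1..m}" by (simp add: v_def w)
    then show ?thesis by (simp only: image_image add_diff_cancel_left' image_ident)
  qed
  ultimately have v: "v \<in> Sym m" by (simp add: permutations_of_set_def)
  have "values_gt w a = v"
    unfolding values_gt_def av[symmetric]
    using standardize_map[of v "(+) a"] standardize_Sym[OF v] by (simp add: strict_mono_on_def)
  then show "values_gt w a \<in> Sym m" "map ((+) a) (values_gt w a) = filter (\<lambda>x. x > a) w"
    using v av by simp_all
qed

lemma Sym_append_iff:
  "u @ v \<in> Sym N \<longleftrightarrow> distinct u \<and> distinct v \<and> set u \<inter> set v = {} \<and> set u \<union> set v = {1..N}"
  unfolding permutations_of_set_def by auto

lemma filter_compl_length: "length (filter (\<lambda>x. x \<le> (a::nat)) w) + length (filter (\<lambda>x. x > a) w) = length w"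
  using sum_length_filter_compl[of "\<lambda>x. x \<le> a" w] by (simp add: not_le)

lemma append_eq_filter:
  "filter R (u @ v) = w \<Longrightarrow> filter R u = take (length (filter R u)) w \<and> filter R v = drop (length (filter R u)) w"
  by auto

text \<open>
  In the permutation matrix of \<open>\<pi>\<close>, cut after position \<open>b\<close> and after value \<open>a\<close>, this is the number of
  points in the block of small positions and small values. It plays the role of the summation
  index \<open>j\<close>.
\<close>

definition crossing :: "nat \<Rightarrow> nat \<Rightarrow> nat list \<Rightarrow> nat" where
  "crossing a b \<pi> = length (filter (\<lambda>x. x \<le> a) (take b \<pi>))"

context
  fixes a b n m l :: nat and \<sigma> \<tau> :: "nat list"
  assumes am: "a + m = l" and bn: "b + n = l" and \<sigma>: "\<sigma> \<in> Sym a" and \<tau>: "\<tau> \<in> Sym b"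
begin

lemma Sym_restr_iff:
  "\<pi> \<in> Sym_restr l \<sigma> \<tau> \<longleftrightarrow>
     \<pi> \<in> Sym l \<and> filter (\<lambda>x. x \<le> a) \<pi> = \<sigma> \<and> standardize (take b \<pi>) = \<tau>"
  using standardize_Sym[OF filter_le_Sym[of \<pi> a m]] am length_Sym[OF \<sigma>] length_Sym[OF \<tau>]
  unfolding Sym_restr_def values_le_def prefix_le_def by auto

text \<open>
  The index \<open>j\<close> fixes the sizes of all four blocks. The small letters of the prefix are
  \<open>\<sigma>\<^sub>1\<dots>\<sigma>\<^sub>j\<close>, and since \<open>\<tau>\<close> is the pattern of the prefix, the values of \<open>\<tau>\<close> up to \<open>j\<close> have the pattern of
  \<open>\<sigma>\<^sub>1\<dots>\<sigma>\<^sub>j\<close>; this is what membership in \<^const>\<open>J\<close> expresses. The values of \<open>\<tau>\<close> above \<open>j\<close>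
  record the pattern of the large letters of the prefix.
\<close>

lemma Sym_restr_blocks:
  assumes "\<pi> \<in> Sym_restr l \<sigma> \<tau>" and "crossing a b \<pi> = j"
  shows "j \<le> a" "j \<le> b" "a \<le> n + j"
    and "filter (\<lambda>x. x \<le> a) (take b \<pi>) = take j \<sigma>"
    and "filter (\<lambda>x. x \<le> a) (drop b \<pi>) = drop j \<sigma>"
    and "filter (\<lambda>x. x > a) (take b \<pi>) = map ((+) a) (take (b - j) (values_gt \<pi> a))"
    and "filter (\<lambda>x. x > a) (drop b \<pi>) = map ((+) a) (drop (b - j) (values_gt \<pi> a))"
    and "j \<in> J \<sigma> \<tau>"
    and "prefix_le (values_gt \<pi> a) (b - j) = values_gt \<tau> j"
    and "values_gt \<pi> a \<in> Sym m"
proof -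
  define u v where "u = take b \<pi>" and "v = drop b \<pi>"
  have p: "\<pi> \<in> Sym (a + m)" and f: "filter (\<lambda>x. x \<le> a) \<pi> = \<sigma>" and su: "standardize u = \<tau>"
    using assms(1) am by (simp_all add: Sym_restr_iff u_def)
  have uv: "\<pi> = u @ v" by (simp add: u_def v_def)
  have lp: "length \<pi> = b + n" using length_Sym[OF p] am bn by simp
  have lu: "length u = b" and lv: "length v = n" using lp by (simp_all add: u_def v_def)
  have du: "distinct u" using p uv by (simp add: permutations_of_set_def)
  have j: "length (filter (\<lambda>x. x \<le> a) u) = j" using assms(2) by (simp add: crossing_def u_def)
  have g: "map ((+) a) (values_gt \<pi> a) = filter (\<lambda>x. x > a) \<pi>"
    by (rule filter_gt_Sym(2)[OF p])
  have g': "filter (\<lambda>x. x > a) (u @ v) = map ((+) a) (values_gt \<pi> a)"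
    unfolding uv[symmetric] by (rule g[symmetric])
  show "values_gt \<pi> a \<in> Sym m" by (rule filter_gt_Sym(1)[OF p])
  have lg: "length (filter (\<lambda>x. x > a) u) = b - j" and jb: "j \<le> b"
    using filter_compl_length[of a u] j lu by simp_all
  have 1: "filter (\<lambda>x. x \<le> a) u = take j \<sigma>" and 2: "filter (\<lambda>x. x \<le> a) v = drop j \<sigma>"
    using append_eq_filter[of "\<lambda>x. x \<le> a" u v \<sigma>] f uv j by simp_all
  have 3: "filter (\<lambda>x. x > a) u = map ((+) a) (take (b - j) (values_gt \<pi> a))"
    and 4: "filter (\<lambda>x. x > a) v = map ((+) a) (drop (b - j) (values_gt \<pi> a))"
    using append_eq_filter[OF g'] unfolding lg take_map drop_map by simp_all
  have la: "length \<sigma> = a" "length \<tau> = b" using \<sigma> \<tau> by (simp_all only: length_Sym)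
  show ja: "j \<le> a" using arg_cong[OF 1, of length] j la by simp
  show "j \<le> b" by fact
  show "a \<le> n + j" using filter_compl_length[of a v] arg_cong[OF 2, of length] lv la by simp
  show "filter (\<lambda>x. x \<le> a) (take b \<pi>) = take j \<sigma>" "filter (\<lambda>x. x \<le> a) (drop b \<pi>) = drop j \<sigma>"
    "filter (\<lambda>x. x > a) (take b \<pi>) = map ((+) a) (take (b - j) (values_gt \<pi> a))"
    "filter (\<lambda>x. x > a) (drop b \<pi>) = map ((+) a) (drop (b - j) (values_gt \<pi> a))"
    using 1 2 3 4 by (simp_all only: u_def v_def)
  have card: "j = card {x \<in> set u. x \<le> a}"
    using distinct_card[of "filter (\<lambda>x. x \<le> a) u"] du j by simp
  have "values_le \<tau> j = standardize (take j \<sigma>)"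
    using standardize_filter_standardize(1)[OF card] su 1 by simp
  then show "j \<in> J \<sigma> \<tau>" using ja jb la by (simp add: J_def prefix_le_def)
  have "values_gt \<tau> j = standardize (map ((+) a) (take (b - j) (values_gt \<pi> a)))"
    using standardize_filter_standardize(2)[OF card] su 3 by simp
  then show "prefix_le (values_gt \<pi> a) (b - j) = values_gt \<tau> j"
    by (simp add: prefix_le_def standardize_map strict_mono_on_def)
qed

text \<open>
  Fix \<open>j\<close>. A permutation \<open>\<pi>\<close> is recovered from the pattern \<open>\<theta>\<close> of its large letters and its suffix \<open>v\<close>:
  the letters of the prefix are those missing from \<open>v\<close>, and their pattern is \<open>\<tau>\<close>.
  The only constraints are that \<open>\<theta>\<close> begins with the pattern that \<open>\<tau>\<close> prescribes and that \<open>v\<close>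
  shuffles what is left of \<open>\<sigma>\<close> with what is left of the large letters. For the converse, the
  prefix \<open>u\<close> is built from its letters and its pattern \<open>\<tau>\<close>; the hypothesis \<open>j \<in> J \<sigma> \<tau>\<close>
  ensures that its small letters then appear in the order in which \<open>\<sigma>\<close> has them.
\<close>

lemma bij_betw_Sym_restr_fibre:
  assumes j: "j \<in> J \<sigma> \<tau>" and k: "a + k = n + j"
  shows "bij_betw (\<lambda>\<pi>. (values_gt \<pi> a, drop b \<pi>))
    {\<pi> \<in> Sym_restr l \<sigma> \<tau>. crossing a b \<pi> = j}
    (SIGMA \<theta>:{\<theta> \<in> Sym m. prefix_le \<theta> (b - j) = values_gt \<tau> j}.
       shuffles (drop j \<sigma>) (map ((+) a) (drop (b - j) \<theta>)))"
    (is "bij_betw ?f ?R ?T")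
proof -
  have la: "length \<sigma> = a" "length \<tau> = b" using \<sigma> \<tau> by (simp_all only: length_Sym)
  have jab: "j \<le> a" "j \<le> b" and J: "prefix_le \<sigma> j = values_le \<tau> j"
    using j la by (auto simp: J_def)
  have d\<sigma>: "distinct \<sigma>" "set \<sigma> = {1..a}" using \<sigma> by (auto simp: permutations_of_set_def)
  have sh: "shuffles (drop j \<sigma>) (map ((+) a) (drop (b - j) \<theta>))
      = {w. filter (\<lambda>x. x \<le> a) w = drop j \<sigma> \<and> filter (\<lambda>x. x > a) w = map ((+) a) (drop (b - j) \<theta>)}"
    if "\<theta> \<in> Sym m" for \<theta>
  proof (rule shuffles_eq_filter)
    show "\<forall>x\<in>set (drop j \<sigma>). x \<le> a" using d\<sigma> set_drop_subset[of j \<sigma>] by auto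
    show "\<forall>y\<in>set (map ((+) a) (drop (b - j) \<theta>)). a < y"
      using that set_drop_subset[of "b - j" \<theta>] by (auto simp: permutations_of_set_def)
  qed
  \<comment> \<open>Given \<open>\<tau>\<close>, the suffix determines \<open>\<pi>\<close>; \<open>\<theta>\<close> is recorded because it carries \<^const>\<open>imaj\<close>.\<close>
  have inj: "inj_on ?f ?R"
  proof (rule inj_onI)
    fix \<pi> \<pi>' assume *: "\<pi> \<in> ?R" "\<pi>' \<in> ?R" "?f \<pi> = ?f \<pi>'"
    have eq: "drop b \<pi> = drop b \<pi>'" using * by simp
    have std: "standardize (take b \<pi>) = standardize (take b \<pi>')"
      using * by (simp add: Sym_restr_iff)
    have "\<pi> \<in> Sym l" "\<pi>' \<in> Sym l" using * by (simp_all add: Sym_restr_iff)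
    then have "take b \<pi> @ drop b \<pi> \<in> Sym l" "take b \<pi>' @ drop b \<pi>' \<in> Sym l"
      by (simp_all only: append_take_drop_id)
    then have "set (take b \<pi>) = set (take b \<pi>')"
      unfolding Sym_append_iff eq by blast
    then have "take b \<pi> = take b \<pi>'" by (rule standardize_inject[OF std])
    then show "\<pi> = \<pi>'" using eq by (metis append_take_drop_id)
  qed
  have sub: "?f \<pi> \<in> ?T" if "\<pi> \<in> ?R" for \<pi>
    using that Sym_restr_blocks[of \<pi> j] by (simp add: sh)
  have surj: "\<exists>\<pi>\<in>?R. ?f \<pi> = (\<theta>, v)" if T: "(\<theta>, v) \<in> ?T" for \<theta> v
  proof -
    have \<theta>: "\<theta> \<in> Sym m" and pre: "prefix_le \<theta> (b - j) = values_gt \<tau> j"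
      and v: "filter (\<lambda>x. x \<le> a) v = drop j \<sigma>" "filter (\<lambda>x. x > a) v = map ((+) a) (drop (b - j) \<theta>)"
      using T by (auto simp: sh)
    have d\<theta>: "distinct \<theta>" "set \<theta> = {1..m}" using \<theta> by (auto simp: permutations_of_set_def)
    have l\<theta>: "length \<theta> = m" "b - j \<le> m" using length_Sym[OF \<theta>] am bn k jab by simp_all
    define s where "s = take j \<sigma>"
    define y where "y = map ((+) a) (take (b - j) \<theta>)"
    have sa: "x \<le> a" if "x \<in> set s" for x
      using that d\<sigma> set_take_subset[of j \<sigma>] by (auto simp: s_def)
    have ya: "x > a" if "x \<in> set y" for x
      using that d\<theta> set_take_subset[of "b - j" \<theta>] by (auto simp: y_def)
    have ds: "distinct s" "length s = j" using d\<sigma> la jab by (simp_all add: s_def)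
    have dy: "distinct y" "length y = b - j" using d\<theta> l\<theta> by (simp_all add: y_def distinct_map)
    have "set s \<inter> set y = {}" using sa ya by fastforce
    then have "card (set s \<union> set y) = b"
      using distinct_card[OF ds(1)] distinct_card[OF dy(1)] ds dy jab by (simp add: card_Un_disjoint)
    then obtain u where u: "distinct u" "set u = set s \<union> set y" "standardize u = \<tau>"
      using ex_word_standardize[of \<tau> "set s \<union> set y"] \<tau> by auto
    have su: "{x \<in> set u. x \<le> a} = set s" "{x \<in> set u. x > a} = set y"
      using sa ya u(2) by fastforce+
    have card: "j = card {x \<in> set u. x \<le> a}"
      unfolding su using distinct_card[OF ds(1)] ds by simp
    have u1: "filter (\<lambda>x. x \<le> a) u = s"
    proof (rule standardize_inject)
      show "standardize (filter (\<lambda>x. x \<le> a) u) = standardize s"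
        using standardize_filter_standardize(1)[OF card] u(3) J by (simp add: s_def prefix_le_def)
      show "set (filter (\<lambda>x. x \<le> a) u) = set s" using su by simp
    qed
    have u2: "filter (\<lambda>x. x > a) u = y"
    proof (rule standardize_inject)
      have "standardize y = values_gt \<tau> j"
        using pre by (simp add: y_def prefix_le_def standardize_map strict_mono_on_def)
      then show "standardize (filter (\<lambda>x. x > a) u) = standardize y"
        using standardize_filter_standardize(2)[OF card] u(3) by simp
      show "set (filter (\<lambda>x. x > a) u) = set y" using su by simp
    qed
    have lu: "length u = b" using u(3) la by (metis length_standardize)
    define \<pi> where "\<pi> = u @ v"
    have f1: "filter (\<lambda>x. x \<le> a) \<pi> = \<sigma>" using u1 v by (simp add: \<pi>_def s_def)
    have f2: "filter (\<lambda>x. x > a) \<pi> = map ((+) a) \<theta>"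
      using u2 v by (simp add: \<pi>_def y_def flip: map_append)
    have p: "\<pi> \<in> Sym (a + m)"
    proof -
      have "\<pi> \<in> shuffles \<sigma> (map ((+) a) \<theta>)"
        using partition_in_shuffles[of \<pi> "\<lambda>x. x \<le> a"] f1 f2 by (simp add: not_le)
      moreover have "set \<sigma> \<inter> set (map ((+) a) \<theta>) = {}" using d\<sigma> d\<theta> by auto
      moreover have "set \<sigma> \<union> set (map ((+) a) \<theta>) = {1..a + m}" using d\<sigma> d\<theta> by auto
      ultimately show ?thesis
        using distinct_disjoint_shuffles[of \<sigma> "map ((+) a) \<theta>" \<pi>] set_shuffles[of \<pi>] d\<sigma> d\<theta>
        by (auto simp: permutations_of_set_def distinct_map)
    qed
    have "map ((+) a) (values_gt \<pi> a) = map ((+) a) \<theta>"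
      using filter_gt_Sym(2)[OF p] f2 by simp
    then have "values_gt \<pi> a = \<theta>" by (rule map_injective) (simp add: inj_on_def)
    moreover have "take b \<pi> = u" "drop b \<pi> = v" using lu by (simp_all add: \<pi>_def)
    moreover have "\<pi> \<in> ?R"
      using p am f1 u(3) u1 ds lu by (simp add: Sym_restr_iff crossing_def \<pi>_def)
    ultimately show ?thesis by blast
  qed
  show ?thesis unfolding bij_betw_def
  proof (intro conjI equalityI subsetI)
    show "inj_on ?f ?R" by (rule inj)
    show "x \<in> ?T" if "x \<in> ?f ` ?R" for x using that sub by blast
    show "x \<in> ?f ` ?R" if x: "x \<in> ?T" for x
    proof -
      obtain \<theta> v where xw: "x = (\<theta>, v)" by (rule prod.exhaust)
      obtain \<pi> where "\<pi> \<in> ?R" "?f \<pi> = (\<theta>, v)" using surj x unfolding xw by blast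
      then show ?thesis unfolding xw by (intro rev_image_eqI) auto
    qed
  qed
qed

end

section \<open>The generating function\<close>

text \<open>
  Group the permutations by \<open>j\<close>. In each fibre the bijection separates the two statistics:
  summing over \<open>v\<close> for fixed \<open>\<theta>\<close> is the shuffle theorem in \<open>q\<close>, and it leaves
  \<open>maj\<close> of the suffix of \<open>\<theta>\<close> as the only trace of \<open>\<theta>\<close>; summing over \<open>\<theta>\<close> is then
  \<open>sum_fibre_prefix\<close>.
\<close>

lemma Sym_restr_gf:
  fixes p q :: "'a::comm_semiring_1"
  assumes "a + m = l" "b + n = l" "\<sigma> \<in> Sym a" "\<tau> \<in> Sym b"
  shows "(\<Sum>\<pi>\<in>Sym_restr l \<sigma> \<tau>. p ^ imaj (values_gt \<pi> a) * q ^ maj (suffix_gt \<pi> b))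
    = (\<Sum>j | j \<in> J \<sigma> \<tau> \<and> a \<le> n + j. p ^ imaj (values_gt \<tau> j) * q ^ maj (suffix_gt \<sigma> j)
         * gauss p (b - j) (n + j - a) * gauss q (a - j) (n + j - a) * A (n + j - a) p q)"
proof -
  let ?h = "\<lambda>\<pi>. p ^ imaj (values_gt \<pi> a) * q ^ maj (suffix_gt \<pi> b)"
  let ?c = "crossing a b"
  let ?I = "{j. j \<in> J \<sigma> \<tau> \<and> a \<le> n + j}"
  have la: "length \<sigma> = a" "length \<tau> = b" using assms by (simp_all only: length_Sym)
  have d\<sigma>: "distinct \<sigma>" "set \<sigma> = {1..a}" using assms by (auto simp: permutations_of_set_def)
  have fibre: "(\<Sum>\<pi> | \<pi> \<in> Sym_restr l \<sigma> \<tau> \<and> ?c \<pi> = j. ?h \<pi>)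
     = p ^ imaj (values_gt \<tau> j) * q ^ maj (suffix_gt \<sigma> j)
         * gauss p (b - j) (n + j - a) * gauss q (a - j) (n + j - a) * A (n + j - a) p q"
    if j: "j \<in> J \<sigma> \<tau>" "a \<le> n + j" for j
  proof -
    define k where "k = n + j - a"
    define s where "s = b - j"
    have jab: "j \<le> a" "j \<le> b" using j la by (auto simp: J_def)
    have m: "m = s + k" and k: "a + k = n + j"
      using assms(1,2) j jab by (simp_all add: k_def s_def)
    let ?S = "{\<theta> \<in> Sym m. prefix_le \<theta> s = values_gt \<tau> j}"
    let ?V = "\<lambda>\<theta>. shuffles (drop j \<sigma>) (map ((+) a) (drop s \<theta>))"
    note bij = bij_betw_Sym_restr_fibre[OF assms j(1) k, folded s_def]
    have "values_gt \<tau> j \<in> Sym s"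
      using filter_gt_Sym(1)[of \<tau> j s] assms(4) jab by (simp add: s_def)
    note prefix_sum = sum_fibre_prefix[where k = k and p = p and q = q, OF this, folded m]
    have inner: "(\<Sum>v\<in>?V \<theta>. q ^ maj v) = q ^ maj (suffix_gt \<sigma> j) * gauss q (a - j) k * q ^ maj (suffix_gt \<theta> s)"
      if \<theta>: "\<theta> \<in> Sym m" for \<theta>
    proof -
      have d\<theta>: "set \<theta> = {1..m}" using \<theta> by (auto simp: permutations_of_set_def)
      have "\<forall>x\<in>set (drop j \<sigma>). \<forall>y\<in>set (map ((+) a) (drop s \<theta>)). x < y"
      proof (intro ballI)
        fix x y assume x: "x \<in> set (drop j \<sigma>)" and y: "y \<in> set (map ((+) a) (drop s \<theta>))"
        have "x \<le> a" using x d\<sigma> set_drop_subset[of j \<sigma>] by auto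
        moreover have "a < y" using y d\<theta> set_drop_subset[of s \<theta>] by auto
        ultimately show "x < y" by simp
      qed
      from sum_shuffles_maj[OF this, of q]
      show ?thesis
        using length_Sym[OF \<theta>] la m maj_map[of "drop s \<theta>" "(+) a"]
        by (simp add: suffix_gt_def maj_standardize strict_mono_on_def power_add algebra_simps)
    qed
    have "(\<Sum>\<pi> | \<pi> \<in> Sym_restr l \<sigma> \<tau> \<and> ?c \<pi> = j. ?h \<pi>)
        = (\<Sum>\<pi> | \<pi> \<in> Sym_restr l \<sigma> \<tau> \<and> ?c \<pi> = j.
             (\<lambda>(\<theta>, v). p ^ imaj \<theta> * q ^ maj v) (values_gt \<pi> a, drop b \<pi>))"
      by (simp add: suffix_gt_def maj_standardize)
    also have "\<dots> = (\<Sum>(\<theta>, v)\<in>Sigma ?S ?V. p ^ imaj \<theta> * q ^ maj v)"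
      by (rule sum.reindex_bij_betw[OF bij])
    also have "\<dots> = (\<Sum>\<theta>\<in>?S. p ^ imaj \<theta> * (\<Sum>v\<in>?V \<theta>. q ^ maj v))"
      by (subst sum.Sigma[symmetric]) (simp_all add: sum_distrib_left)
    also have "\<dots> = (\<Sum>\<theta>\<in>?S. q ^ maj (suffix_gt \<sigma> j) * gauss q (a - j) k
                        * (p ^ imaj \<theta> * q ^ maj (suffix_gt \<theta> s)))"
      by (rule sum.cong[OF refl]) (simp add: inner algebra_simps)
    also have "\<dots> = q ^ maj (suffix_gt \<sigma> j) * gauss q (a - j) k
        * (p ^ imaj (values_gt \<tau> j) * gauss p s k * A k p q)"
      unfolding sum_distrib_left[symmetric] prefix_sum ..
    finally show ?thesis by (simp add: k_def s_def algebra_simps)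
  qed
  have finI: "finite ?I" by (simp add: J_def)
  have finS: "finite (Sym_restr l \<sigma> \<tau>)" by (simp add: Sym_restr_def)
  have "?c ` Sym_restr l \<sigma> \<tau> \<subseteq> ?I"
    using Sym_restr_blocks[OF assms] by blast
  then have "(\<Sum>\<pi>\<in>Sym_restr l \<sigma> \<tau>. ?h \<pi>)
      = (\<Sum>j\<in>?I. \<Sum>\<pi> | \<pi> \<in> Sym_restr l \<sigma> \<tau> \<and> ?c \<pi> = j. ?h \<pi>)"
    by (rule sum.group[OF finS finI, symmetric])
  also have "\<dots> = (\<Sum>j\<in>?I. p ^ imaj (values_gt \<tau> j) * q ^ maj (suffix_gt \<sigma> j)
         * gauss p (b - j) (n + j - a) * gauss q (a - j) (n + j - a) * A (n + j - a) p q)"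
    by (rule sum.cong[OF refl], rule fibre) simp_all
  finally show ?thesis .
qed

text \<open>
  An index \<open>j\<close> with \<open>n + j < a\<close> contributes nothing. On the left \<open>k = n + j - a\<close> is a natural number;
  on the right it is an integer, and the terms with \<open>k < 0\<close> are zero.
\<close>

lemma sum_J_as_int_index:
  assumes "\<And>j. j \<in> J \<sigma> \<tau> \<Longrightarrow> a \<le> n + j \<Longrightarrow> f j = (g j (n + j - a) :: 'a::comm_monoid_add)"
  shows "(\<Sum>j | j \<in> J \<sigma> \<tau> \<and> a \<le> n + j. f j)
    = (\<Sum>j\<in>J \<sigma> \<tau>. let k = int n - int a + int j in if k < 0 then 0 else g j (nat k))"
proof -
  have "(\<Sum>j | j \<in> J \<sigma> \<tau> \<and> a \<le> n + j. f j) = (\<Sum>j\<in>J \<sigma> \<tau>. if a \<le> n + j then f j else 0)"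
    by (rule sum.inter_filter) (simp add: J_def)
  also have "\<dots> = (\<Sum>j\<in>J \<sigma> \<tau>. let k = int n - int a + int j in if k < 0 then 0 else g j (nat k))"
  proof (rule sum.cong[OF refl])
    fix j assume j: "j \<in> J \<sigma> \<tau>"
    have "nat (int n - int a + int j) = n + j - a" by simp
    then show "(if a \<le> n + j then f j else 0)
        = (let k = int n - int a + int j in if k < 0 then 0 else g j (nat k))"
      using assms[OF j] by (simp add: Let_def)
  qed
  finally show ?thesis .
qed

theorem theorem1p4:
  fixes a b n m l :: nat and \<sigma> \<tau> :: "nat list"
  assumes "a + m = l" and "b + n = l"
    and "\<sigma> \<in> Sym a" and "\<tau> \<in> Sym b"
  shows "(\<Sum>\<pi>\<in>Sym_restr l \<sigma> \<tau>. P ^ imaj (values_gt \<pi> a) * Q ^ maj (suffix_gt \<pi> b)) =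
      (\<Sum>j\<in>J \<sigma> \<tau>. let k = int n - int a + int j in
         if k < 0 then 0
         else P ^ imaj (values_gt \<tau> j) * Q ^ maj (suffix_gt \<sigma> j)
           * qbinomial P m (nat k) * qbinomial Q n (nat k) * A (nat k) P Q)
    \<and> card (Sym_restr l \<sigma> \<tau>) =
      (\<Sum>j\<in>J \<sigma> \<tau>. let k = int n - int a + int j in
         if k < 0 then 0
         else (m choose nat k) * (n choose nat k) * fact (nat k))"
proof
  have sizes: "m = (b - j) + (n + j - a)" "n = (a - j) + (n + j - a)"
    if "j \<in> J \<sigma> \<tau>" "a \<le> n + j" for j
    using that assms(1,2) length_Sym[OF assms(3)] length_Sym[OF assms(4)] by (auto simp: J_def)
  show "(\<Sum>\<pi>\<in>Sym_restr l \<sigma> \<tau>. P ^ imaj (values_gt \<pi> a) * Q ^ maj (suffix_gt \<pi> b)) =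
      (\<Sum>j\<in>J \<sigma> \<tau>. let k = int n - int a + int j in
         if k < 0 then 0
         else P ^ imaj (values_gt \<tau> j) * Q ^ maj (suffix_gt \<sigma> j)
           * qbinomial P m (nat k) * qbinomial Q n (nat k) * A (nat k) P Q)"
    unfolding Sym_restr_gf[OF assms]
  proof (rule sum_J_as_int_index)
    fix j assume j: "j \<in> J \<sigma> \<tau>" "a \<le> n + j"
    have "qbinomial P m (n + j - a) = gauss P (b - j) (n + j - a)"
      by (subst sizes(1)[OF j]) (rule qbinomial_eq_gauss[OF qfact_P_nonzero])
    moreover have "qbinomial Q n (n + j - a) = gauss Q (a - j) (n + j - a)"
      using qbinomial_eq_gauss[OF qfact_Q_nonzero, of "a - j" "n + j - a"]
      unfolding sizes(2)[OF j, symmetric] .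
    ultimately show "P ^ imaj (values_gt \<tau> j) * Q ^ maj (suffix_gt \<sigma> j)
           * gauss P (b - j) (n + j - a) * gauss Q (a - j) (n + j - a) * A (n + j - a) P Q
        = P ^ imaj (values_gt \<tau> j) * Q ^ maj (suffix_gt \<sigma> j)
           * qbinomial P m (n + j - a) * qbinomial Q n (n + j - a) * A (n + j - a) P Q"
      by simp
  qed
  have "card (Sym_restr l \<sigma> \<tau>)
      = (\<Sum>\<pi>\<in>Sym_restr l \<sigma> \<tau>. 1 ^ imaj (values_gt \<pi> a) * 1 ^ maj (suffix_gt \<pi> b))"
    by simp
  also have "\<dots> = (\<Sum>j\<in>J \<sigma> \<tau>. let k = int n - int a + int j in
         if k < 0 then 0
         else (m choose nat k) * (n choose nat k) * fact (nat k))"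
    unfolding Sym_restr_gf[OF assms]
  proof (rule sum_J_as_int_index)
    fix j assume j: "j \<in> J \<sigma> \<tau>" "a \<le> n + j"
    have "A (n + j - a) 1 (1::nat) = fact (n + j - a)" by (simp add: A_def)
    then show "1 ^ imaj (values_gt \<tau> j) * 1 ^ maj (suffix_gt \<sigma> j)
           * gauss 1 (b - j) (n + j - a) * gauss 1 (a - j) (n + j - a) * A (n + j - a) 1 1
        = (m choose (n + j - a)) * (n choose (n + j - a)) * fact (n + j - a)"
      unfolding gauss_one sizes(1,2)[OF j, symmetric] by simp
  qed
  finally show "card (Sym_restr l \<sigma> \<tau>) = \<dots>" .
qed

end
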